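(* Let $k\ge 0$ be an integer and let $a_0,a_1,\dots,a_{k+1}$ be positive real numbers. Then \[\frac{[a_0,a_1,\dots,a_k]+[a_0,a_1,\dots,a_k,a_{k+1}]}{2}=[a_0,a_1,\dots,a_k,2a_{k+1},a_k,\dots,a_1],\] \[\sqrt{[a_0,a_1,\dots,a_k]\cdot[a_0,a_1,\dots,a_k,a_{k+1}]}=[a_0,\overline{a_1,\dots,a_k,2a_{k+1},a_k,\dots,a_1,2a_0}],\] \[\frac{2}{\frac{1}{[a_0,a_1,\dots,a_k]}+\frac{1}{[a_0,a_1,\dots,a_k,a_{k+1}]}}=[a_0,a_1,\dots,a_k,2a_{k+1},a_k,\dots,a_1,a_0],\] \[\cot\left(\frac{\cot^{-1}[a_0,a_1,\dots,a_k]+\cot^{-1}[a_0,a_1,\dots,a_k,a_{k+1}]}{2}\right)=[\overline{a_0,a_1,\dots,a_k,2a_{k+1},a_k,\dots,a_1,a_0}].\]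
   Context: For numbers $a_0,a_1,\dots$, the continued fraction $[a_0,a_1,\dots,a_n]$ denotes $a_0+\cfrac{1}{a_1+\cfrac{1}{\ddots+\cfrac{1}{a_n}}}$ (and $[a_0]=a_0$); an infinite continued fraction $[a_0,a_1,a_2,\dots]$ denotes the limit of the finite ones $[a_0,\dots,a_n]$ as $n\to\infty$ (which exists for positive real entries). An overline denotes a block repeated infinitely often, e.g. $[a_0,\overline{b_1,\dots,b_m}]=[a_0,b_1,\dots,b_m,b_1,\dots,b_m,\dots]$. When $k=0$, the block "$a_k,\dots,a_1$" is empty. $\cot^{-1}$ denotes the inverse cotangent with values in $(0,\pi)$, and the square root is the positive one. *)

theory Defs
  imports Complex_Main "HOL-Library.Stream"
begin

text \<open>The value on the empty list is a dummy; a continued fraction always has a zeroth entry.\<close>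

fun cfrac :: "real list \<Rightarrow> real" where
  "cfrac [] = 0"
| "cfrac [a] = a"
| "cfrac (a # b # xs) = a + 1 / cfrac (b # xs)"

text \<open>Like \<^const>\<open>sums\<close>, a relation: it asserts convergence of the infinite continued
  fraction as well as its value.\<close>

definition has_cfrac_value :: "real stream \<Rightarrow> real \<Rightarrow> bool" where
  "has_cfrac_value s x \<longleftrightarrow> (\<lambda>n. cfrac (stake (Suc n) s)) \<longlonglongrightarrow> x"

definition arccot :: "real \<Rightarrow> real" where
  "arccot x = (THE y. 0 < y \<and> y < pi \<and> cot y = x)"

end

theory Submission
  imports Defs
begin

text \<open>Expanding a block is applying a Moebius map to the tail that follows it. The block
  \<open>a\<^sub>0, \<dots>, a\<^sub>k, 2 a\<^sub>k\<^sub>+\<^sub>1, a\<^sub>k, \<dots>, a\<^sub>0\<close> gives a symmetric matrix,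
  and the four means are read off from it: the arithmetic and harmonic means are the ratios of
  its columns, the other two are positive fixed points. A fixed point is the value of the
  periodic continued fraction because two consecutive steps contract uniformly. The fixed point
  equation \<open>z - 1 / z = 2 (x y - 1) / (x + y)\<close> of the full palindrome is the duplication
  formula \<open>cot \<theta> - tan \<theta> = 2 cot (2 \<theta>)\<close> with \<open>2 \<theta> = arccot x + arccot y\<close>.\<close>

section \<open>Continued fractions as functions of their tail\<close>

definition cfrac_tail :: "real list \<Rightarrow> real \<Rightarrow> real" where
  "cfrac_tail l t = foldr (\<lambda>a t. a + 1 / t) l t"

lemma cfrac_tail_simps [simp]:
  "cfrac_tail [] t = t"
  "cfrac_tail (a # l) t = a + 1 / cfrac_tail l t"
  "cfrac_tail (l @ l') t = cfrac_tail l (cfrac_tail l' t)"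
  by (simp_all add: cfrac_tail_def)

text \<open>Since \<open>1 / 0 = 0\<close>, the tail \<open>0\<close> stands for the point at infinity.\<close>

lemma cfrac_eq_cfrac_tail: "cfrac l = cfrac_tail l 0"
  by (induction l rule: cfrac.induct) auto

lemma cfrac_tail_ge:
  assumes "d > 0" "\<And>b. b \<in> set l \<Longrightarrow> d \<le> b" "d \<le> t"
  shows "d \<le> cfrac_tail l t"
  using assms
proof (induction l)
  case (Cons a l)
  then have "0 < cfrac_tail l t" "d \<le> a" by fastforce+
  then show ?case by (simp add: add_increasing2)
qed simp

lemma cfrac_tail_pos:
  assumes "\<And>b. b \<in> set l \<Longrightarrow> 0 < b" "0 < t"
  shows "0 < cfrac_tail l t"
  using assms by (induction l) (auto intro!: add_pos_pos)

section \<open>Contraction and convergence\<close>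

text \<open>One step need not contract, but two consecutive steps do: the derivative of
  \<open>t \<mapsto> a + 1 / (b + 1 / t)\<close> is \<open>1 / (b t + 1)\<^sup>2\<close>.\<close>

lemma cfrac_tail_contraction:
  assumes "d > 0" "\<And>b. b \<in> set l \<Longrightarrow> d \<le> b" "d \<le> u" "d \<le> v"
  shows "\<bar>cfrac_tail l u - cfrac_tail l v\<bar>
    \<le> (1 / (1 + d\<^sup>2)) ^ (length l div 2) * ((1 + 1 / d\<^sup>2) * \<bar>u - v\<bar>)"
  using assms(2)
proof (induction l rule: induct_list012)
  \<comment> \<open>With fewer than two entries there is no double step; the factor
    \<open>1 + 1 / d\<^sup>2\<close> covers the Lipschitz constants \<open>1\<close> and
    \<open>1 / d\<^sup>2\<close> of these two cases.\<close>
  case 1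
  then show ?case using \<open>d > 0\<close> by (simp add: algebra_simps)
next
  case (2 a)
  have "d\<^sup>2 \<le> u * v"
    using assms by (auto simp: power2_eq_square intro!: mult_mono)
  moreover have "0 < d\<^sup>2" using \<open>d > 0\<close> by simp
  ultimately have uv: "1 / (u * v) \<le> 1 + 1 / d\<^sup>2"
    by (smt (verit) frac_le)
  have "1 / u - 1 / v = (v - u) * (1 / (u * v))"
    using assms by (simp add: field_simps)
  then have "\<bar>1 / u - 1 / v\<bar> = 1 / (u * v) * \<bar>u - v\<bar>"
    using assms by (simp add: abs_mult)
  also have "\<dots> \<le> (1 + 1 / d\<^sup>2) * \<bar>u - v\<bar>"
    using uv by (intro mult_right_mono) auto
  finally show ?case by simp
next
  case (3 a b l)
  define U V where "U = cfrac_tail l u" and "V = cfrac_tail l v"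
  have UV: "d \<le> U" "d \<le> V" "d \<le> b"
    unfolding U_def V_def using 3 assms by (auto intro!: cfrac_tail_ge)
  have "d\<^sup>2 \<le> b * U" "d\<^sup>2 \<le> b * V"
    using assms UV by (auto simp: power2_eq_square intro!: mult_mono)
  moreover have "0 \<le> d\<^sup>2" by simp
  ultimately have ge: "1 + d\<^sup>2 \<le> b * U + 1" "1 \<le> b * V + 1" by linarith+
  then have "(1 + d\<^sup>2) * 1 \<le> (b * U + 1) * (b * V + 1)"
    using \<open>0 \<le> d\<^sup>2\<close> by (intro mult_mono) linarith+
  moreover have "0 < 1 + d\<^sup>2" using \<open>0 \<le> d\<^sup>2\<close> by linarith
  ultimately have le: "1 / ((b * U + 1) * (b * V + 1)) \<le> 1 / (1 + d\<^sup>2)"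
    by (simp add: frac_le)
  have nz: "b * U + 1 \<noteq> 0" "b * V + 1 \<noteq> 0" using ge \<open>0 < 1 + d\<^sup>2\<close> by linarith+
  have "1 / (b + 1 / U) = U / (b * U + 1)" "1 / (b + 1 / V) = V / (b * V + 1)"
    using UV assms by (auto simp: field_simps)
  then have "1 / (b + 1 / U) - 1 / (b + 1 / V)
      = (U * (b * V + 1) - V * (b * U + 1)) / ((b * U + 1) * (b * V + 1))"
    using diff_frac_eq[OF nz, of U V] by (simp only:)
  also have "U * (b * V + 1) - V * (b * U + 1) = U - V" by (simp add: algebra_simps)
  finally have "1 / (b + 1 / U) - 1 / (b + 1 / V) = (U - V) / ((b * U + 1) * (b * V + 1))" .
  then have "\<bar>1 / (b + 1 / U) - 1 / (b + 1 / V)\<bar> = 1 / ((b * U + 1) * (b * V + 1)) * \<bar>U - V\<bar>"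
    using ge \<open>0 < 1 + d\<^sup>2\<close> by (simp add: abs_mult)
  also have "\<dots> \<le> 1 / (1 + d\<^sup>2) * \<bar>U - V\<bar>"
    using le by (intro mult_right_mono) auto
  also have "\<dots> \<le> 1 / (1 + d\<^sup>2) *
      ((1 / (1 + d\<^sup>2)) ^ (length l div 2) * ((1 + 1 / d\<^sup>2) * \<bar>u - v\<bar>))"
    using 3 \<open>0 < 1 + d\<^sup>2\<close> unfolding U_def V_def by (intro mult_left_mono) auto
  finally show ?case by (simp add: U_def V_def mult.assoc)
qed

text \<open>The candidate \<open>x\<close> comes with its complete quotients, so no Cauchy argument
  is needed: \<open>x\<close> and a convergent arise from the same block with two different tails,
  and the contraction drives them together. The common lower bound \<open>d\<close> makes the rate
  uniform.\<close>

lemma has_cfrac_value_if_complete_quotients: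
  assumes d: "d > 0" and s: "\<And>n. d \<le> s !! n"
    and x: "\<And>n. \<exists>t\<ge>d. x = cfrac_tail (stake n s) t"
  shows "has_cfrac_value s x"
proof -
  define r where "r = 1 / (1 + d\<^sup>2)"
  have dpos: "0 < d\<^sup>2" using d by simp
  have r: "0 \<le> r" "r < 1" using dpos by (auto simp: r_def divide_less_eq_1 intro: add_pos_pos)
  define C where "C = (1 + 1 / d\<^sup>2) * (1 / d)"
  have bound: "norm (cfrac (stake (Suc n) s) - x) \<le> r ^ (n div 2) * C" for n
  proof -
    obtain t where t: "t \<ge> d" "x = cfrac_tail (stake (Suc n) s) t" using x by blast
    \<comment> \<open>Moving entry \<open>n\<close> into the tail leaves a block shared with the
      convergent, whose tail is \<open>s !! n\<close>; the two tails differ by \<open>1 / t\<close>,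
      hence the factor \<open>1 / d\<close> in \<open>C\<close>.\<close>
    have x': "x = cfrac_tail (stake n s) (s !! n + 1 / t)"
      by (simp only: t stake_Suc cfrac_tail_simps)
    have c: "cfrac (stake (Suc n) s) = cfrac_tail (stake n s) (s !! n)"
      by (simp add: cfrac_eq_cfrac_tail stake_Suc del: stake.simps)
    have "1 / t \<le> 1 / d" "0 < 1 / t" using t d by (auto simp: frac_le)
    have "\<bar>cfrac_tail (stake n s) (s !! n) - cfrac_tail (stake n s) (s !! n + 1 / t)\<bar>
      \<le> (1 / (1 + d\<^sup>2)) ^ (length (stake n s) div 2)
        * ((1 + 1 / d\<^sup>2) * \<bar>s !! n - (s !! n + 1 / t)\<bar>)"
    proof (rule cfrac_tail_contraction[OF d])
      show "d \<le> b" if "b \<in> set (stake n s)" for b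
        using that s by (metis in_set_conv_nth length_stake stake_nth)
      show "d \<le> s !! n" "d \<le> s !! n + 1 / t"
        using s[of n] \<open>0 < 1 / t\<close> by linarith+
    qed
    also have "\<dots> = r ^ (n div 2) * ((1 + 1 / d\<^sup>2) * (1 / t))"
      using \<open>0 < 1 / t\<close> by (simp add: r_def)
    also have "\<dots> \<le> r ^ (n div 2) * C"
      unfolding C_def using r \<open>1 / t \<le> 1 / d\<close> dpos by (intro mult_left_mono) auto
    finally show ?thesis by (simp only: c flip: x' real_norm_def)
  qed
  have "filterlim (\<lambda>n::nat. n div 2) sequentially sequentially"
    by (rule filterlim_at_top_div_const_nat) simp
  then have "(\<lambda>n. r ^ (n div 2)) \<longlonglongrightarrow> 0"
    using filterlim_compose[OF LIMSEQ_realpow_zero[OF r]] by blast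
  then have "(\<lambda>n. cfrac (stake (Suc n) s) - x) \<longlonglongrightarrow> 0"
    by (rule tendsto_0_le[where K = C]) (use bound r in simp)
  then show ?thesis
    unfolding has_cfrac_value_def using LIM_zero_iff by blast
qed

text \<open>After a whole period the complete quotient is \<open>z\<close> again; inside a period it
  is the value of the rest of the block followed by \<open>z\<close>. Both are at least the minimum
  of \<open>z\<close> and the entries.\<close>

lemma has_cfrac_value_cycle:
  assumes "l \<noteq> []" and pos: "\<And>b. b \<in> set l \<Longrightarrow> 0 < b"
    and z: "0 < z" "cfrac_tail l z = z"
  shows "has_cfrac_value (cycle l) z"
proof -
  define d where "d = Min (insert z (set l))"
  have d: "d > 0" "d \<le> z" and dl: "\<And>b. b \<in> set l \<Longrightarrow> d \<le> b"
    using pos z by (auto simp: d_def)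
  have cyc: "cycle l = l @- cycle l" using \<open>l \<noteq> []\<close> by (rule cycle_decomp)
  show ?thesis
  proof (rule has_cfrac_value_if_complete_quotients[OF \<open>d > 0\<close>])
    show "d \<le> cycle l !! n" for n
    proof (induction n rule: less_induct)
      case (less n)
      show ?case
        using less[of "n - length l"] length_greater_0_conv[THEN iffD2, OF \<open>l \<noteq> []\<close>] dl
        by (subst cyc) (cases "n < length l"; simp add: shift_snth del: length_greater_0_conv)
    qed
    show "\<exists>t\<ge>d. z = cfrac_tail (stake n (cycle l)) t" for n
    proof (induction n rule: less_induct)
      case (less n)
      show ?case
      proof (cases "n < length l")
        case True
        have "stake n (cycle l) = take n l"
          using True by (subst cyc) (simp add: stake_shift)
        moreover have "z = cfrac_tail (take n l) (cfrac_tail (drop n l) z)"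
          using z(2) by (metis append_take_drop_id cfrac_tail_simps(3))
        moreover have "d \<le> cfrac_tail (drop n l) z"
          using d dl by (intro cfrac_tail_ge) (auto dest: in_set_dropD)
        ultimately show ?thesis by auto
      next
        case False
        then have "n - length l < n"
          using length_greater_0_conv[THEN iffD2, OF \<open>l \<noteq> []\<close>] by linarith
        then obtain t where "t \<ge> d" "z = cfrac_tail (stake (n - length l) (cycle l)) t"
          using less by blast
        moreover have "stake n (cycle l) = l @ stake (n - length l) (cycle l)"
          using False by (subst cyc) (simp add: stake_shift)
        ultimately show ?thesis
          using z(2) by (metis cfrac_tail_simps(3))
      qed
    qed
  qed
qed

lemma has_cfrac_value_SCons:
  assumes "has_cfrac_value s z" "z \<noteq> 0"
  shows "has_cfrac_value (b ## s) (b + 1 / z)"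
proof -
  have "(\<lambda>n. b + 1 / cfrac (stake (Suc n) s)) \<longlonglongrightarrow> b + 1 / z"
    using assms unfolding has_cfrac_value_def by (intro tendsto_intros)
  then have "(\<lambda>n. cfrac (stake (Suc (Suc n)) (b ## s))) \<longlonglongrightarrow> b + 1 / z"
    by (simp add: cfrac_eq_cfrac_tail)
  then show ?thesis
    unfolding has_cfrac_value_def by (rule LIMSEQ_imp_Suc)
qed

section \<open>Reversal and palindromes\<close>

text \<open>The matrix of \<^term>\<open>cfrac_tail l\<close> is a product of symmetric matrices, so reversing the
  list transposes it.\<close>

lemma cfrac_tail_moebius:
  assumes "\<forall>b\<in>set l. 0 < b"
  shows "\<exists>p p' q q'. 0 < p \<and> 0 \<le> p' \<and> 0 \<le> q \<and> 0 \<le> q' \<and> 0 < q + q' \<and> 0 < p' + q' \<and>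
    (\<forall>t>0. cfrac_tail l t = (p * t + p') / (q * t + q')) \<and>
    (\<forall>t>0. cfrac_tail (rev l) t = (p * t + q) / (p' * t + q')) \<and>
    1 / cfrac_tail l 0 = q / p \<and> 1 / cfrac_tail (rev l) 0 = p' / p"
  using assms
proof (induction l)
  case Nil
  \<comment> \<open>The identity matrix. The claims at tail \<open>0\<close> are about reciprocals
    because \<open>1 / 0 = 0\<close> then gives the right value \<open>q / p = 0\<close> for the
    empty list.\<close>
  show ?case by (intro exI[of _ 1] exI[of _ 0]) simp
next
  case (Cons a l)
  have a: "0 < a" using Cons.prems by simp
  have "\<forall>b\<in>set l. 0 < b" using Cons.prems by simp
  from Cons.IH[OF this] obtain p p' q q' where *:
    "0 < p" "0 \<le> p'" "0 \<le> q" "0 \<le> q'" "0 < q + q'" "0 < p' + q'"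
    "\<forall>t>0. cfrac_tail l t = (p * t + p') / (q * t + q')"
    "\<forall>t>0. cfrac_tail (rev l) t = (p * t + q) / (p' * t + q')"
    "1 / cfrac_tail l 0 = q / p" "1 / cfrac_tail (rev l) 0 = p' / p"
    by (elim exE conjE) (rule that)
  have pos: "0 < p * t + p'" "0 < p' * t + q'" if "0 < t" for t
    using that * by (cases "p' = 0"; simp add: add_pos_nonneg)+
  show ?case
  \<comment> \<open>Prepending \<open>a\<close> multiplies the matrix with rows
    \<open>(p, p')\<close> and \<open>(q, q')\<close> from the left by the one with rows
    \<open>(a, 1)\<close> and \<open>(1, 0)\<close>.\<close>
  proof (rule exI[of _ "a * p + q"], rule exI[of _ "a * p' + q'"], rule exI[of _ p],
      rule exI[of _ p'], intro conjI allI impI)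
    show "0 < a * p + q" "0 \<le> a * p' + q'" "0 \<le> p" "0 \<le> p'" "0 < p + p'"
      using a * by (simp_all add: add_pos_nonneg)
    show "0 < a * p' + q' + p'" using pos(2)[OF a] * by (simp add: mult.commute)
    show "cfrac_tail (a # l) t = ((a * p + q) * t + (a * p' + q')) / (p * t + p')"
      if "0 < t" for t
      using *(7)[rule_format, OF that] pos[OF that] by (simp add: field_simps)
    show "cfrac_tail (rev (a # l)) t = ((a * p + q) * t + p) / ((a * p' + q') * t + p')"
      if "0 < t" for t
    proof -
      have t: "0 < a + 1 / t" using a that by (simp add: add_pos_pos)
      have "cfrac_tail (rev (a # l)) t = (p * (a + 1 / t) + q) / (p' * (a + 1 / t) + q')"
        using *(8)[rule_format, OF t] by simp
      also have "\<dots> = (t * (p * (a + 1 / t) + q)) / (t * (p' * (a + 1 / t) + q'))"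
        using that by simp
      also have "t * (p * (a + 1 / t) + q) = (a * p + q) * t + p"
        using that by (simp add: field_simps)
      also have "t * (p' * (a + 1 / t) + q') = (a * p' + q') * t + p'"
        using that by (simp add: field_simps)
      finally show ?thesis .
    qed
    show "1 / cfrac_tail (a # l) 0 = p / (a * p + q)"
      using *(1) by (simp add: *(9)) (simp add: field_simps)
    show "1 / cfrac_tail (rev (a # l)) 0 = (a * p' + q') / (a * p + q)"
      using *(8)[rule_format, OF a] by (simp add: mult.commute)
  qed
qed

text \<open>The matrix of the full palindrome is symmetric, with entries in the proportion
  \<open>2 x y : x + y : 2\<close>.\<close>

lemma cfrac_palindrome:
  fixes a c :: real
  assumes l: "\<forall>b\<in>set l. 0 < b" and a: "0 < a" and c: "0 < c"
  defines "x \<equiv> cfrac (a # l)" and "y \<equiv> cfrac (a # l @ [c])"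
    and "mid \<equiv> l @ [2 * c] @ rev l"
  shows "a \<le> x" "a < y"
    "cfrac (a # mid) = (x + y) / 2"
    "cfrac (a # mid @ [a]) = 2 * x * y / (x + y)"
    "\<And>t. 0 < t \<Longrightarrow>
      cfrac_tail (a # mid @ [a]) t = (2 * x * y * t + (x + y)) / ((x + y) * t + 2)"
proof -
  from cfrac_tail_moebius[OF l] obtain p p' q q' where *:
    "0 < p" "0 \<le> p'" "0 \<le> q" "0 \<le> q'" "0 < q + q'" "0 < p' + q'"
    "\<forall>t>0. cfrac_tail l t = (p * t + p') / (q * t + q')"
    "\<forall>t>0. cfrac_tail (rev l) t = (p * t + q) / (p' * t + q')"
    "1 / cfrac_tail l 0 = q / p" "1 / cfrac_tail (rev l) 0 = p' / p"
    by (elim exE conjE) (rule that)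
  \<comment> \<open>\<open>e / f\<close> is the value of \<open>l\<close> followed by the tail
    \<open>c\<close>, so \<open>x\<close> and \<open>y\<close> exceed \<open>a\<close> by
    \<open>q / p\<close> and \<open>f / e\<close>.\<close>
  define e where "e = p * c + p'"
  define f where "f = q * c + q'"
  have e: "0 < e" using * c by (simp add: e_def add_pos_nonneg)
  have f: "0 < f" using * c by (cases "q = 0"; simp add: f_def add_pos_nonneg)
  have x: "x = a + q / p" by (simp add: x_def cfrac_eq_cfrac_tail *)
  have y: "y = a + f / e" using *(7)[rule_format, OF c]
    by (simp add: y_def cfrac_eq_cfrac_tail e_def f_def)
  show "a \<le> x" "a < y" using * e f by (simp_all add: x y)
  define g h where "g = q / p" and "h = f / e"
  have gh: "0 \<le> g" "0 < h" using * e f by (auto simp: g_def h_def)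
  \<comment> \<open>\<open>2 * c + p' / p\<close> is the tail of \<open>l\<close> inside
    \<open>mid\<close>, with infinity behind \<open>rev l\<close>; the value of \<open>mid\<close>
    becomes the reciprocal of \<open>(g + h) / 2\<close>.\<close>
  have "p * (2 * c + p' / p) + p' = 2 * e" "q * (2 * c + p' / p) + q' = f + g * e"
    using * by (auto simp: e_def f_def g_def field_simps)
  moreover have "0 < 2 * c + p' / p" using * c by (simp add: add_pos_nonneg)
  ultimately have "cfrac_tail l (2 * c + p' / p) = 2 * e / (f + g * e)"
    using *(7) by metis
  then show "cfrac (a # mid) = (x + y) / 2"
    using e f by (simp add: mid_def cfrac_eq_cfrac_tail * x y g_def add_divide_distrib)
  \<comment> \<open>Only the excesses \<open>g\<close> and \<open>h\<close> over \<open>a\<close>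
    survive: all entries of the matrix of \<open>mid\<close> share the factor \<open>p * e\<close>,
    which cancels.\<close>
  have tail: "a + 1 / cfrac_tail mid \<tau> = a + ((g + h) * \<tau> + 2 * g * h) / (2 * \<tau> + g + h)"
    if "0 < \<tau>" for \<tau>
  proof -
    define u v where "u = p * \<tau> + q" and "v = p' * \<tau> + q'"
    have u: "0 < u" using * that by (simp add: u_def add_pos_nonneg)
    have v: "0 \<le> v" using * that by (simp add: v_def)
    have "0 < 2 * c + v / u" using u v c by (simp add: add_pos_nonneg)
    then have "1 / cfrac_tail mid \<tau> = (q * (2 * c + v / u) + q') / (p * (2 * c + v / u) + p')"
      using *(7,8) that by (simp add: mid_def u_def v_def)
    also have "\<dots> = (u * (q * (2 * c + v / u) + q')) / (u * (p * (2 * c + v / u) + p'))"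
      using u by simp
    also have "u * (q * (2 * c + v / u) + q') = (e * q + f * p) * \<tau> + 2 * f * q"
      using u by (simp add: field_simps) (simp add: u_def v_def e_def f_def algebra_simps)
    also have "\<dots> = (p * e) * ((g + h) * \<tau> + 2 * g * h)"
      using * e by (simp add: g_def h_def field_simps)
    also have "u * (p * (2 * c + v / u) + p') = 2 * e * p * \<tau> + e * q + f * p"
      using u by (simp add: field_simps) (simp add: u_def v_def e_def f_def algebra_simps)
    also have "\<dots> = (p * e) * (2 * \<tau> + g + h)"
      using * e by (simp add: g_def h_def field_simps)
    finally show ?thesis using * e by simp
  qed
  have xy_gh: "x = a + g" "y = a + h" by (simp_all add: x y g_def h_def)
  \<comment> \<open>The closing \<open>a\<close> has nothing behind it, so it acts as the tail
    \<open>a\<close> of \<open>mid\<close>.\<close>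
  show "cfrac (a # mid @ [a]) = 2 * x * y / (x + y)"
    using tail[OF a] a gh
    by (simp add: cfrac_eq_cfrac_tail xy_gh) (simp add: divide_simps algebra_simps)
  show "cfrac_tail (a # mid @ [a]) t = (2 * x * y * t + (x + y)) / ((x + y) * t + 2)"
    if "0 < t" for t
  proof -
    define \<tau> where "\<tau> = a + 1 / t"
    have tau: "0 < \<tau>" "\<tau> * t = a * t + 1"
      using a that by (auto simp: \<tau>_def add_pos_pos field_simps)
    have "cfrac_tail (a # mid @ [a]) t = a + ((g + h) * \<tau> + 2 * g * h) / (2 * \<tau> + g + h)"
      using tail[OF tau(1)] by (simp add: \<tau>_def)
    also have "\<dots> = (a * (2 * \<tau> + g + h) + ((g + h) * \<tau> + 2 * g * h)) / (2 * \<tau> + g + h)"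
      using tau gh by (simp add: field_simps)
    also have "\<dots> = (t * (a * (2 * \<tau> + g + h) + ((g + h) * \<tau> + 2 * g * h)))
        / (t * (2 * \<tau> + g + h))"
      using that by simp
    also have "t * (a * (2 * \<tau> + g + h) + ((g + h) * \<tau> + 2 * g * h)) = 2 * x * y * t + (x + y)"
      using tau(2) unfolding xy_gh by algebra
    also have "t * (2 * \<tau> + g + h) = (x + y) * t + 2"
      using tau(2) unfolding xy_gh by algebra
    finally show ?thesis .
  qed
qed

section \<open>Half sums of inverse cotangents\<close>

lemma arccot_eq: "arccot x = pi / 2 - arctan x"
  unfolding arccot_def
proof (rule the_equality)
  show "0 < pi / 2 - arctan x \<and> pi / 2 - arctan x < pi \<and> cot (pi / 2 - arctan x) = x"
    using arctan_bounded[of x] by (auto simp: cot_def sin_diff cos_diff tan_arctan[unfolded tan_def])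
  fix y :: real
  assume y: "0 < y \<and> y < pi \<and> cot y = x"
  then have "tan (pi / 2 - y) = x"
    by (auto simp: tan_def cot_def sin_diff cos_diff)
  then have "arctan x = pi / 2 - y"
    using y by (intro arctan_unique) auto
  then show "y = pi / 2 - arctan x" by simp
qed

text \<open>The quadratic is the duplication formula with denominators cleared. Its roots have
  product \<open>-1\<close>, so positivity, which holds because both angles are acute, singles out
  one of them.\<close>

lemma cot_half_sum_arccot:
  assumes "0 < x" "0 < y"
  defines "z \<equiv> cot ((arccot x + arccot y) / 2)"
  shows "0 < z" "(x + y) * z\<^sup>2 = 2 * (x * y - 1) * z + (x + y)"
proof -
  define \<alpha> \<beta> \<theta> where "\<alpha> = arccot x" and "\<beta> = arccot y" and "\<theta> = (\<alpha> + \<beta>) / 2"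
  have bd: "0 < \<alpha>" "\<alpha> < pi / 2" "0 < \<beta>" "\<beta> < pi / 2"
    using arctan_bounded[of x] arctan_bounded[of y] assms(1,2)
    by (auto simp: \<alpha>_def \<beta>_def arccot_eq)
  then have th: "0 < \<theta>" "\<theta> < pi / 2" by (auto simp: \<theta>_def)
  have sc: "0 < sin \<theta>" "0 < cos \<theta>" using th by (auto intro: sin_gt_zero cos_gt_zero)
  have z: "z = cos \<theta> / sin \<theta>" by (simp add: z_def cot_def \<theta>_def \<alpha>_def \<beta>_def)
  then show "0 < z" using sc by simp
  have cs: "cos \<alpha> = x * sin \<alpha>" "cos \<beta> = y * sin \<beta>"
    by (auto simp: \<alpha>_def \<beta>_def arccot_eq sin_diff cos_diff sin_arctan cos_arctan)
  have sum: "\<alpha> + \<beta> = 2 * \<theta>" by (simp add: \<theta>_def)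
  \<comment> \<open>Both functions of the double angle are multiples of the same product of sines,
    so cross-multiplying relates them without any division.\<close>
  have "sin (2 * \<theta>) = (x + y) * (sin \<alpha> * sin \<beta>)"
    unfolding sum[symmetric] sin_add cs by (simp add: algebra_simps)
  moreover have "cos (2 * \<theta>) = (x * y - 1) * (sin \<alpha> * sin \<beta>)"
    unfolding sum[symmetric] cos_add cs by (simp add: algebra_simps)
  ultimately have "(x + y) * cos (2 * \<theta>) = (x * y - 1) * sin (2 * \<theta>)" by simp
  then have "(x + y) * ((cos \<theta>)\<^sup>2 - (sin \<theta>)\<^sup>2) = (x * y - 1) * (2 * sin \<theta> * cos \<theta>)"
    by (simp only: sin_double cos_double)
  moreover have "cos \<theta> = z * sin \<theta>" using sc by (simp add: z)
  ultimately have "(sin \<theta>)\<^sup>2 * ((x + y) * z\<^sup>2) = (sin \<theta>)\<^sup>2 * (2 * (x * y - 1) * z + (x + y))"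
    by algebra
  then show "(x + y) * z\<^sup>2 = 2 * (x * y - 1) * z + (x + y)"
    using sc by simp
qed

section \<open>Reading off the four means\<close>

theorem theorem1p1:
  fixes k :: nat and a :: "nat \<Rightarrow> real"
  assumes pos: "\<And>i. i \<le> k + 1 \<Longrightarrow> a i > 0"
  defines "x \<equiv> cfrac (map a [0..<k + 1])"
    and "y \<equiv> cfrac (map a [0..<k + 2])"
    and "mid \<equiv> map a [1..<k + 1] @ [2 * a (k + 1)] @ rev (map a [1..<k + 1])"
  shows "(x + y) / 2 = cfrac (a 0 # mid)
    \<and> has_cfrac_value (a 0 ## cycle (mid @ [2 * a 0])) (sqrt (x * y))
    \<and> 2 / (1 / x + 1 / y) = cfrac (a 0 # mid @ [a 0])
    \<and> has_cfrac_value (cycle (a 0 # mid @ [a 0])) (cot ((arccot x + arccot y) / 2))"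
proof -
  define l where "l = map a [1..<k + 1]"
  have l: "\<forall>b\<in>set l. 0 < b" using pos by (auto simp: l_def)
  have a0: "0 < a 0" and c: "0 < a (k + 1)" using pos by auto
  have x: "x = cfrac (a 0 # l)" by (simp add: x_def l_def upt_rec[of 0] del: upt_Suc)
  have y: "y = cfrac (a 0 # l @ [a (k + 1)])"
    by (simp add: y_def l_def upt_rec[of 0] del: upt_Suc) (simp add: upt_Suc_append)
  have mid: "mid = l @ [2 * a (k + 1)] @ rev l" by (simp add: mid_def l_def)
  note pal = cfrac_palindrome[OF l a0 c, folded x y mid]
  have mid_pos: "0 < b" if "b \<in> set mid" for b using that l c by (auto simp: mid)
  have xy: "0 < x" "0 < y" using pal(1,2) a0 by linarith+

  define s where "s = sqrt (x * y)"
  have s2: "s * s = x * y" using xy by (simp add: s_def)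
  \<comment> \<open>The strict inequality comes from \<open>a 0 < y\<close>; it makes the complete
    quotient \<open>1 / (s - a 0)\<close> positive.\<close>
  have "a 0 * a 0 < x * y" using pal(1,2) a0 xy by (intro mult_le_less_imp_less) auto
  then have "a 0 < s" using a0 by (simp add: s_def real_less_rsqrt power2_eq_square)
  then have s: "0 < s" using a0 by linarith
  \<comment> \<open>The full palindrome at \<open>t = 1 / s\<close> puts the tail
    \<open>a 0 + s\<close> behind \<open>mid\<close>; since \<open>x * y = s * s\<close>, its
    Moebius map sends \<open>1 / s\<close> to \<open>s\<close>.\<close>
  have "a 0 + 1 / cfrac_tail mid (a 0 + s)
      = (2 * (s * s) * (1 / s) + (x + y)) / ((x + y) * (1 / s) + 2)"
    using pal(5)[of "1 / s"] s s2 by simp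
  also have "\<dots> = s"
    using s xy by (simp add: field_simps add_pos_pos)
  finally have "1 / cfrac_tail mid (a 0 + s) = s - a 0" by simp
  then have "cfrac_tail mid (a 0 + s) = 1 / (s - a 0)"
    by (metis inverse_eq_divide inverse_inverse_eq)
  \<comment> \<open>The period ends in \<open>2 * a 0\<close>, and
    \<open>2 * a 0 + (s - a 0)\<close> is the tail \<open>a 0 + s\<close> from above, so
    \<open>1 / (s - a 0)\<close> is a fixed point.\<close>
  then have "has_cfrac_value (cycle (mid @ [2 * a 0])) (1 / (s - a 0))"
    using \<open>a 0 < s\<close> a0 mid_pos by (intro has_cfrac_value_cycle) (auto simp: algebra_simps)
  then have "has_cfrac_value (a 0 ## cycle (mid @ [2 * a 0])) (a 0 + 1 / (1 / (s - a 0)))"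
    using \<open>a 0 < s\<close> by (intro has_cfrac_value_SCons) auto
  then have geometric: "has_cfrac_value (a 0 ## cycle (mid @ [2 * a 0])) s" by simp

  define z where "z = cot ((arccot x + arccot y) / 2)"
  have z: "0 < z" "(x + y) * z\<^sup>2 = 2 * (x * y - 1) * z + (x + y)"
    using cot_half_sum_arccot[OF xy] by (auto simp: z_def)
  have "0 < (x + y) * z + 2" using xy z by (simp add: add_pos_pos)
  moreover have "2 * x * y * z + (x + y) = z * ((x + y) * z + 2)"
    using z(2) by (simp add: algebra_simps power2_eq_square)
  ultimately have "cfrac_tail (a 0 # mid @ [a 0]) z = z"
    using pal(5)[OF z(1)] by simp
  then have "has_cfrac_value (cycle (a 0 # mid @ [a 0])) z"
    using z(1) a0 mid_pos by (intro has_cfrac_value_cycle) auto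
  moreover have "2 / (1 / x + 1 / y) = cfrac (a 0 # mid @ [a 0])"
    using pal(4) xy by (simp add: field_simps)
  ultimately show ?thesis
    using pal(3) geometric by (simp add: s_def z_def)
qed

end
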